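(* Consider the volume-integral discretization $\omega_k\sum_{l=0}^pD_{kl}\widetilde{\mathbf D}(\mathbf U^k_j,\mathbf U^l_j)$, $0\le k\le p$, of the DGSEM in a cell $\kappa_j$, with $\widetilde{\mathbf D}(\mathbf u^-,\mathbf u^+)=\mathbf h(\mathbf u^-,\mathbf u^+)+\mathbf h(\mathbf u^+,\mathbf u^-)+\mathbf d^-(\mathbf u^-,\mathbf u^+)-\mathbf d^+(\mathbf u^+,\mathbf u^-)$ built from the entropy conservative Baer–Nunziato fluxes $\mathbf h,\mathbf d^\pm$ given in the context. This discretization is kinetic energy preserving: for each phase $i=1,2$, the volume terms of the advective part of the cell-averaged kinetic energy are in conservation form, that is, for all continuously differentiable $t\mapsto\mathbf U^k_j(t)\in\Omega$, $0\le k\le p$, $$\sum_{k=0}^p\Big(u^k_{i,j}\,\Delta^{\alpha\rho u,k}_{i,j}-\tfrac12(u^k_{i,j})^2\,\Delta^{\alpha\rho,k}_{i,j}\Big)=h\frac{d}{dt}\langle K_i(\mathbf u_h)\rangle_j+u^p_{i,j}K^p_{i,j}-u^0_{i,j}K^0_{i,j},$$ where $K^k_{i,j}=\frac12\alpha^k_{i,j}\rho^k_{i,j}(u^k_{i,j})^2$, $\langle K_i(\mathbf u_h)\rangle_j=\frac12\sum_{k=0}^p\omega_kK^k_{i,j}$, and $\Delta^{\alpha\rho,k}_{i,j}$, $\Delta^{\alpha\rho u,k}_{i,j}$ are the time derivative plus the advective volume terms of the mass and momentum equations of phase $i$ defined in the context.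
   Context: **Model.** Fix constants $C_{v,i}>0$, $\gamma_i>1$, $p_{\infty,i}\ge0$ ($i=1,2$), $\chi\in\{0,\frac12,1\}$ and $\beta_s\ge0$. The unknown is $$\mathbf u=(\alpha_1,\ \alpha_1\rho_1,\ \alpha_1\rho_1u_1,\ \alpha_1\rho_1E_1,\ \alpha_2\rho_2,\ \alpha_2\rho_2u_2,\ \alpha_2\rho_2E_2)^\top\in\mathbb R^7,\qquad \alpha_2=1-\alpha_1,$$ with void fractions $\alpha_i$, densities $\rho_i$, velocities $u_i$, specific total energies $E_i=e_i+u_i^2/2$. Pressure: $p_i=(\gamma_i-1)\rho_ie_i-\gamma_ip_{\infty,i}$. Temperature $T_i$ is defined by $\rho_ie_i=\rho_iC_{v,i}T_i+p_{\infty,i}$, $\theta_i=1/T_i$. The phase space $\Omega$ is the set of $\mathbf u$ with $0<\alpha_i<1$, $\rho_i>0$, $u_i\in\mathbb R$, $e_i>0$, $T_i>0$, $i=1,2$. Interface quantities: $u_I=\beta u_1+(1-\beta)u_2$, $p_I=\mu p_1+(1-\mu)p_2$, $\beta=\frac{\chi\alpha_1\rho_1}{\chi\alpha_1\rho_1+(1-\chi)\alpha_2\rho_2}$, $\mu=\frac{(1-\beta)T_2}{\beta T_1+(1-\beta)T_2}$. **Means and jumps.** For values $a^\pm$ at $\mathbf u^\pm$: $[\![a]\!]=a^+-a^-$, $\overline a=\frac{a^++a^-}2$, and for $a^\pm>0$ the logarithmic mean $\hat a=[\![a]\!]/[\![\ln a]\!]$ ($\hat a=a^-$ if $a^-=a^+$).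 **Fluxes.** A column $(a_i,b_i,c_i,d_i)^\top$, $i=1,2$, denotes $(a_1,b_1,c_1,d_1,b_2,c_2,d_2)^\top\in\mathbb R^7$ (void fraction, then mass, momentum, energy of each phase). Then $$\mathbf h(\mathbf u^-,\mathbf u^+)=\begin{pmatrix}0\\ \overline\alpha_i\overline u_i\hat\rho_i\\ \overline\alpha_i\big(\overline u_i^2\hat\rho_i+\frac{\overline{p_i\theta_i}}{\overline\theta_i}\big)\\ \overline\alpha_i\overline u_i\big(\hat\rho_i\big(\frac{C_{v,i}}{\hat\theta_i}+\frac{u_i^-u_i^+}2\big)+\frac{\overline{p_i\theta_i}}{\overline\theta_i}+p_{\infty,i}\big)\end{pmatrix}-\beta_s\frac{[\![\alpha_i]\!]}2\begin{pmatrix}1\\ \hat\rho_i\\ \hat\rho_i\overline u_i\\ \hat\rho_i\big(\frac{C_{v,i}}{\hat\theta_i}+\frac{u_i^-u_i^+}2\big)+p_{\infty,i}\end{pmatrix},\quad \mathbf d^\pm(\mathbf u^-,\mathbf u^+)=\frac{[\![\alpha_i]\!]}2\begin{pmatrix}u_I^\pm\\0\\-p_I^\pm\\-p_I^\pm u_I^\pm\end{pmatrix}.$$ **DGSEM.** $p\ge1$; $-1=s_0<\dots<s_p=1$ are the Gauss–Lobatto nodes on $[-1,1]$, $\omega_k>0$ the weights ($\sum_k\omega_k=2$), $\ell_k$ the Lagrange polynomials at these nodes, $D_{kl}=\ell_l'(s_k)$, satisfying $\omega_kD_{kl}+\omega_lD_{lk}=\delta_{kp}\delta_{lp}-\delta_{k0}\delta_{l0}$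 and $\sum_lD_{kl}=0$. The cell $\kappa_j$ has length $h>0$; $\mathbf U^k_j$ is the nodal state at the $k$th node of $\kappa_j$, with components denoted $\alpha^k_{i,j},\rho^k_{i,j},u^k_{i,j}$, etc. **Advective parts.** Let $h_i^{\alpha\rho}(\mathbf u^-,\mathbf u^+)$ denote the symmetrized mass component of $\mathbf h$ for phase $i$, i.e. one half of the sum of the phase-$i$ mass components of $\mathbf h(\mathbf u^-,\mathbf u^+)$ and $\mathbf h(\mathbf u^+,\mathbf u^-)$, so $h_i^{\alpha\rho}=\overline\alpha_i\overline u_i\hat\rho_i$. Omitting the pressure term $\overline\alpha_i\overline{p_i\theta_i}/\overline\theta_i$ and the nonconservative terms $\mathbf d^\pm$ in the momentum component, the time derivative plus the advective volume terms are $$\Delta^{\alpha\rho,k}_{i,j}=\frac{\omega_kh}2\frac{d}{dt}(\alpha^k_{i,j}\rho^k_{i,j})+\sum_{l=0}^p2\omega_kD_{kl}h_i^{\alpha\rho}(\mathbf U^k_j,\mathbf U^l_j),$$ $$\Delta^{\alpha\rho u,k}_{i,j}=\frac{\omega_kh}2\frac{d}{dt}(\alpha^k_{i,j}\rho^k_{i,j}u^k_{i,j})+\sum_{l=0}^p2\omega_kD_{kl}\frac{u^k_{i,j}+u^l_{i,j}}2h_i^{\alpha\rho}(\mathbf U^k_j,\mathbf U^l_j).$$ *)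

theory Defs
  imports "HOL-Analysis.Analysis" "HOL-Computational_Algebra.Polynomial"
begin

section \<open>The Baer--Nunziato model\<close>

datatype phase = Ph1 | Ph2

record bn_model =
  Cv :: "phase \<Rightarrow> real"
  gam :: "phase \<Rightarrow> real"
  pinf :: "phase \<Rightarrow> real"
  chi :: real
  bs :: real

text \<open>A state is the vector of conserved variables
  \<open>(\<alpha>1, \<alpha>1 \<rho>1, \<alpha>1 \<rho>1 u1, \<alpha>1 \<rho>1 E1, \<alpha>2 \<rho>2, \<alpha>2 \<rho>2 u2, \<alpha>2 \<rho>2 E2)\<close>; the
  primitive quantities below are recovered from it.\<close>

type_synonym state = "real ^ 7"

fun mass_ix :: "phase \<Rightarrow> 7" where
  "mass_ix Ph1 = 2"
| "mass_ix Ph2 = 5"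

fun mom_ix :: "phase \<Rightarrow> 7" where
  "mom_ix Ph1 = 3"
| "mom_ix Ph2 = 6"

fun ener_ix :: "phase \<Rightarrow> 7" where
  "ener_ix Ph1 = 4"
| "ener_ix Ph2 = 7"

fun alpha :: "phase \<Rightarrow> state \<Rightarrow> real" where
  "alpha Ph1 u = u $ 1"
| "alpha Ph2 u = 1 - u $ 1"

definition rho :: "phase \<Rightarrow> state \<Rightarrow> real" where
  "rho i u = u $ mass_ix i / alpha i u"

definition vel :: "phase \<Rightarrow> state \<Rightarrow> real" where
  "vel i u = u $ mom_ix i / u $ mass_ix i"

definition tot_energy :: "phase \<Rightarrow> state \<Rightarrow> real" where
  "tot_energy i u = u $ ener_ix i / u $ mass_ix i"

definition int_energy :: "phase \<Rightarrow> state \<Rightarrow> real" where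
  "int_energy i u = tot_energy i u - (vel i u)\<^sup>2 / 2"

definition pressure :: "bn_model \<Rightarrow> phase \<Rightarrow> state \<Rightarrow> real" where
  "pressure M i u = (gam M i - 1) * rho i u * int_energy i u - gam M i * pinf M i"

text \<open>The relation \<open>\<rho> e = \<rho> Cv T + pinf\<close> solved for \<open>T\<close>.\<close>

definition temp :: "bn_model \<Rightarrow> phase \<Rightarrow> state \<Rightarrow> real" where
  "temp M i u = (rho i u * int_energy i u - pinf M i) / (rho i u * Cv M i)"

definition theta :: "bn_model \<Rightarrow> phase \<Rightarrow> state \<Rightarrow> real" where
  "theta M i u = 1 / temp M i u"

definition phase_space :: "bn_model \<Rightarrow> state set" where
  "phase_space M = {u. \<forall>i. 0 < alpha i u \<and> alpha i u < 1 \<and> 0 < rho i u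
                          \<and> 0 < int_energy i u \<and> 0 < temp M i u}"

definition beta_I :: "bn_model \<Rightarrow> state \<Rightarrow> real" where
  "beta_I M u = chi M * alpha Ph1 u * rho Ph1 u /
     (chi M * alpha Ph1 u * rho Ph1 u + (1 - chi M) * alpha Ph2 u * rho Ph2 u)"

definition mu_I :: "bn_model \<Rightarrow> state \<Rightarrow> real" where
  "mu_I M u = (1 - beta_I M u) * temp M Ph2 u /
     (beta_I M u * temp M Ph1 u + (1 - beta_I M u) * temp M Ph2 u)"

definition vel_I :: "bn_model \<Rightarrow> state \<Rightarrow> real" where
  "vel_I M u = beta_I M u * vel Ph1 u + (1 - beta_I M u) * vel Ph2 u"

definition pres_I :: "bn_model \<Rightarrow> state \<Rightarrow> real" where
  "pres_I M u = mu_I M u * pressure M Ph1 u + (1 - mu_I M u) * pressure M Ph2 u"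


section \<open>Means, jumps and the entropy conservative fluxes\<close>

text \<open>In all two-point quantities the first state is \<open>u\<^sup>-\<close> and the second one is \<open>u\<^sup>+\<close>.\<close>

definition jump :: "(state \<Rightarrow> real) \<Rightarrow> state \<Rightarrow> state \<Rightarrow> real" where
  "jump f um up = f up - f um"

definition avg :: "(state \<Rightarrow> real) \<Rightarrow> state \<Rightarrow> state \<Rightarrow> real" where
  "avg f um up = (f um + f up) / 2"

definition logmean :: "(state \<Rightarrow> real) \<Rightarrow> state \<Rightarrow> state \<Rightarrow> real" where
  "logmean f um up =
     (if f um = f up then f um else jump f um up / jump (\<lambda>u. ln (f u)) um up)"

text \<open>The two-phase column \<open>(a\<^sub>i, b\<^sub>i, c\<^sub>i, d\<^sub>i)\<close>; its void fraction entry appears only once,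
  for the first phase.\<close>

definition col ::
  "(phase \<Rightarrow> real) \<Rightarrow> (phase \<Rightarrow> real) \<Rightarrow> (phase \<Rightarrow> real) \<Rightarrow> (phase \<Rightarrow> real) \<Rightarrow> state" where
  "col a b c d = vector [a Ph1, b Ph1, c Ph1, d Ph1, b Ph2, c Ph2, d Ph2]"

definition ptheta_mean :: "bn_model \<Rightarrow> phase \<Rightarrow> state \<Rightarrow> state \<Rightarrow> real" where
  "ptheta_mean M i um up =
     avg (\<lambda>u. pressure M i u * theta M i u) um up / avg (theta M i) um up"

definition energy_mean :: "bn_model \<Rightarrow> phase \<Rightarrow> state \<Rightarrow> state \<Rightarrow> real" where
  "energy_mean M i um up =
     Cv M i / logmean (theta M i) um up + vel i um * vel i up / 2"

definition flux_h :: "bn_model \<Rightarrow> state \<Rightarrow> state \<Rightarrow> state" where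
  "flux_h M um up =
     col (\<lambda>i. 0)
         (\<lambda>i. avg (alpha i) um up * avg (vel i) um up * logmean (rho i) um up)
         (\<lambda>i. avg (alpha i) um up *
               ((avg (vel i) um up)\<^sup>2 * logmean (rho i) um up + ptheta_mean M i um up))
         (\<lambda>i. avg (alpha i) um up * avg (vel i) um up *
               (logmean (rho i) um up * energy_mean M i um up
                + ptheta_mean M i um up + pinf M i))
   - col (\<lambda>i. bs M * (jump (alpha i) um up / 2))
         (\<lambda>i. bs M * (jump (alpha i) um up / 2) * logmean (rho i) um up)
         (\<lambda>i. bs M * (jump (alpha i) um up / 2) * (logmean (rho i) um up * avg (vel i) um up))
         (\<lambda>i. bs M * (jump (alpha i) um up / 2) *
               (logmean (rho i) um up * energy_mean M i um up + pinf M i))"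

text \<open>Common form of \<open>d\<^sup>-\<close> and \<open>d\<^sup>+\<close>: the interface quantities are evaluated at \<open>w\<close>.\<close>

definition flux_d :: "bn_model \<Rightarrow> state \<Rightarrow> state \<Rightarrow> state \<Rightarrow> state" where
  "flux_d M w um up =
     col (\<lambda>i. jump (alpha i) um up / 2 * vel_I M w)
         (\<lambda>i. 0)
         (\<lambda>i. jump (alpha i) um up / 2 * (- pres_I M w))
         (\<lambda>i. jump (alpha i) um up / 2 * (- pres_I M w * vel_I M w))"

definition flux_dminus :: "bn_model \<Rightarrow> state \<Rightarrow> state \<Rightarrow> state" where
  "flux_dminus M um up = flux_d M um um up"

definition flux_dplus :: "bn_model \<Rightarrow> state \<Rightarrow> state \<Rightarrow> state" where
  "flux_dplus M um up = flux_d M up um up"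

definition Dtilde :: "bn_model \<Rightarrow> state \<Rightarrow> state \<Rightarrow> state" where
  "Dtilde M um up =
     flux_h M um up + flux_h M up um + flux_dminus M um up - flux_dplus M up um"

definition h_alpha_rho :: "bn_model \<Rightarrow> phase \<Rightarrow> state \<Rightarrow> state \<Rightarrow> real" where
  "h_alpha_rho M i um up =
     (flux_h M um up $ mass_ix i + flux_h M up um $ mass_ix i) / 2"


section \<open>DGSEM in one cell\<close>

text \<open>Gauss--Lobatto rule with \<open>p + 1\<close> points: the quadrature rule on \<open>[-1, 1]\<close> that contains
  both end points as nodes and is exact for polynomials of degree at most \<open>2 p - 1\<close>. These
  conditions determine nodes and weights uniquely.\<close>

definition gauss_lobatto :: "nat \<Rightarrow> (nat \<Rightarrow> real) \<Rightarrow> (nat \<Rightarrow> real) \<Rightarrow> bool" where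
  "gauss_lobatto p s w \<longleftrightarrow>
     strict_mono_on {..p} s \<and> s 0 = -1 \<and> s p = 1 \<and> (\<forall>k\<le>p. 0 < w k) \<and>
     (\<forall>q :: real poly. degree q \<le> 2 * p - 1 \<longrightarrow>
        (\<Sum>k\<le>p. w k * poly q (s k)) = integral {-1..1} (poly q))"

definition lagrange :: "nat \<Rightarrow> (nat \<Rightarrow> real) \<Rightarrow> nat \<Rightarrow> real poly" where
  "lagrange p s k = (\<Prod>i\<in>{..p} - {k}. smult (1 / (s k - s i)) [:- s i, 1:])"

definition Dmat :: "nat \<Rightarrow> (nat \<Rightarrow> real) \<Rightarrow> nat \<Rightarrow> nat \<Rightarrow> real" where
  "Dmat p s k l = poly (pderiv (lagrange p s l)) (s k)"

text \<open>The full volume integral discretization in the equation of node \<open>k\<close>, for nodal values \<open>V\<close>.\<close>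

definition volume_term ::
  "bn_model \<Rightarrow> nat \<Rightarrow> (nat \<Rightarrow> real) \<Rightarrow> (nat \<Rightarrow> real) \<Rightarrow> (nat \<Rightarrow> state) \<Rightarrow> nat \<Rightarrow> state" where
  "volume_term M p s w V k = w k *\<^sub>R (\<Sum>l\<le>p. Dmat p s k l *\<^sub>R Dtilde M (V k) (V l))"

text \<open>Time derivative plus advective volume terms at node \<open>k\<close> and time \<open>t\<close>, for a cell of length
  \<open>h\<close> with nodal states \<open>U k t\<close>.\<close>

definition Delta_mass ::
  "bn_model \<Rightarrow> nat \<Rightarrow> (nat \<Rightarrow> real) \<Rightarrow> (nat \<Rightarrow> real) \<Rightarrow> real \<Rightarrow> (nat \<Rightarrow> real \<Rightarrow> state)
     \<Rightarrow> phase \<Rightarrow> nat \<Rightarrow> real \<Rightarrow> real" where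
  "Delta_mass M p s w h U i k t =
     w k * h / 2 * deriv (\<lambda>\<tau>. alpha i (U k \<tau>) * rho i (U k \<tau>)) t
     + (\<Sum>l\<le>p. 2 * w k * Dmat p s k l * h_alpha_rho M i (U k t) (U l t))"

definition Delta_mom ::
  "bn_model \<Rightarrow> nat \<Rightarrow> (nat \<Rightarrow> real) \<Rightarrow> (nat \<Rightarrow> real) \<Rightarrow> real \<Rightarrow> (nat \<Rightarrow> real \<Rightarrow> state)
     \<Rightarrow> phase \<Rightarrow> nat \<Rightarrow> real \<Rightarrow> real" where
  "Delta_mom M p s w h U i k t =
     w k * h / 2 * deriv (\<lambda>\<tau>. alpha i (U k \<tau>) * rho i (U k \<tau>) * vel i (U k \<tau>)) t
     + (\<Sum>l\<le>p. 2 * w k * Dmat p s k l * ((vel i (U k t) + vel i (U l t)) / 2)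
              * h_alpha_rho M i (U k t) (U l t))"

definition kin :: "phase \<Rightarrow> state \<Rightarrow> real" where
  "kin i u = 1 / 2 * alpha i u * rho i u * (vel i u)\<^sup>2"

definition cell_avg_kin :: "nat \<Rightarrow> (nat \<Rightarrow> real) \<Rightarrow> phase \<Rightarrow> (nat \<Rightarrow> state) \<Rightarrow> real" where
  "cell_avg_kin p w i V = 1 / 2 * (\<Sum>k\<le>p. w k * kin i (V k))"


section \<open>Relation of the advective parts to the full volume terms\<close>

lemma col_nth:
  "col a b c d $ mass_ix i = b i"
  "col a b c d $ mom_ix i = c i"
  by (cases i; simp add: col_def vector_def)+

lemma two_point_commute:
  "avg f up um = avg f um up"
  "logmean f up um = logmean f um up"
  "jump f up um = - jump f um up"
proof -
  show "avg f up um = avg f um up" "jump f up um = - jump f um up"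
    by (simp_all add: avg_def jump_def)
  have "(f um - f up) / (ln (f um) - ln (f up)) = (f up - f um) / (ln (f up) - ln (f um))"
    by (metis minus_diff_eq minus_divide_divide)
  then show "logmean f up um = logmean f um up"
    by (simp add: logmean_def jump_def)
qed

lemma h_alpha_rho_eq:
  "h_alpha_rho M i um up = avg (alpha i) um up * avg (vel i) um up * logmean (rho i) um up"
  by (simp add: h_alpha_rho_def flux_h_def col_nth two_point_commute[of _ up um])

lemma volume_term_mass:
  "volume_term M p s w V k $ mass_ix i
     = (\<Sum>l\<le>p. 2 * w k * Dmat p s k l * h_alpha_rho M i (V k) (V l))"
proof -
  have "Dtilde M um up $ mass_ix i = 2 * h_alpha_rho M i um up" for um up
    by (simp add: Dtilde_def flux_dminus_def flux_dplus_def flux_d_def col_nth h_alpha_rho_def)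
  then show ?thesis
    by (simp add: volume_term_def sum_distrib_left mult_ac)
qed

text \<open>The last two summands are the pressure and nonconservative terms omitted from
  \<^const>\<open>Delta_mom\<close>.\<close>

lemma volume_term_mom:
  "volume_term M p s w V k $ mom_ix i
     = (\<Sum>l\<le>p. 2 * w k * Dmat p s k l * ((vel i (V k) + vel i (V l)) / 2)
              * h_alpha_rho M i (V k) (V l))
     + (\<Sum>l\<le>p. 2 * w k * Dmat p s k l
              * (avg (alpha i) (V k) (V l) * ptheta_mean M i (V k) (V l)))
     - (\<Sum>l\<le>p. w k * Dmat p s k l * (jump (alpha i) (V k) (V l) * pres_I M (V k)))"
proof -
  have "Dtilde M um up $ mom_ix i
      = 2 * (((vel i um + vel i up) / 2) * h_alpha_rho M i um up)
      + 2 * (avg (alpha i) um up * ptheta_mean M i um up)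
      - jump (alpha i) um up * pres_I M um" for um up
  proof -
    have pt: "ptheta_mean M i up um = ptheta_mean M i um up"
      by (simp add: ptheta_mean_def two_point_commute[of _ up um])
    have v: "(vel i um + vel i up) / 2 = avg (vel i) um up"
      by (simp add: avg_def)
    show ?thesis
      unfolding v h_alpha_rho_eq
      by (simp add: Dtilde_def flux_h_def flux_dminus_def flux_dplus_def flux_d_def col_nth pt
          two_point_commute[of _ up um] power2_eq_square algebra_simps)
  qed
  then show ?thesis
    unfolding volume_term_def
    by (simp add: sum_distrib_left flip: sum.distrib sum_subtractf)
       (rule sum.cong[OF refl], simp add: field_simps)
qed

end

theory Submission imports Defs begin

text \<open>The Gauss--Lobatto rule is exact on \<open>(\<ell>\<^sub>k \<ell>\<^sub>l)'\<close>, which gives the summation-by-parts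
  identity for \<open>\<omega>\<^sub>k D\<^sub>k\<^sub>l\<close>. Multiplying the momentum equation by \<open>u\<^sub>k\<close> and the mass equation by
  \<open>u\<^sub>k\<^sup>2 / 2\<close> turns the volume terms into \<open>\<Sum> \<omega>\<^sub>k D\<^sub>k\<^sub>l u\<^sub>k u\<^sub>l h\<^sub>k\<^sub>l\<close>, where \<open>u\<^sub>k u\<^sub>l h\<^sub>k\<^sub>l\<close> is symmetric
  in \<open>k, l\<close>, so that summation by parts leaves only its values at the two end nodes. The time
  derivatives combine by the chain rule for \<open>m\<^sup>2 / (2 r)\<close>, with \<open>m\<close> the momentum and \<open>r\<close> the mass.\<close>

text \<open>At its own node every factor equals 1, the denominators being nonzero by injectivity. At
  another node \<open>s j\<close> the factor with index \<open>j\<close> vanishes.\<close>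

lemma poly_lagrange_node:
  assumes "inj_on s {..p}" "j \<le> p" "k \<le> p"
  shows "poly (lagrange p s k) (s j) = of_bool (j = k)"
proof (cases "j = k")
  case True
  have "poly (smult (1 / (s k - s i)) [:- s i, 1:]) (s k) = 1" if "i \<in> {..p} - {k}" for i
  proof -
    have "s k - s i \<noteq> 0"
      using that assms by (auto dest: inj_onD)
    then show ?thesis
      unfolding poly_smult by simp
  qed
  then show ?thesis
    unfolding lagrange_def poly_prod True by (simp add: prod.neutral)
next
  case False
  then show ?thesis
    using assms by (auto simp: lagrange_def poly_prod intro!: prod_zero bexI[of _ j])
qed

lemma degree_lagrange_le:
  assumes "k \<le> p"
  shows "degree (lagrange p s k) \<le> p"
proof -
  have "degree (lagrange p s k) \<le> (\<Sum>i\<in>{..p} - {k}. degree (smult (1 / (s k - s i)) [:- s i, 1:]))"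
    unfolding lagrange_def
    by (rule degree_prod_sum_le[unfolded o_def]) simp
  also have "\<dots> \<le> (\<Sum>i\<in>{..p} - {k}. 1)"
    by (intro sum_mono order_trans[OF degree_smult_le]) simp
  also have "\<dots> = p"
    using assms by simp
  finally show ?thesis .
qed

lemma integral_poly_pderiv:
  fixes q :: "real poly"
  assumes "a \<le> b"
  shows "integral {a..b} (poly (pderiv q)) = poly q b - poly q a"
proof (rule integral_unique, rule fundamental_theorem_of_calculus[OF assms])
  fix x
  show "(poly q has_vector_derivative poly (pderiv q) x) (at x within {a..b})"
    unfolding has_real_derivative_iff_has_vector_derivative[symmetric]
    by (rule DERIV_subset[OF poly_DERIV]) simp
qed

lemma gauss_lobatto_summation_by_parts:
  assumes gl: "gauss_lobatto p s w" and k: "k \<le> p" and l: "l \<le> p"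
  shows "w k * Dmat p s k l + w l * Dmat p s l k
       = of_bool (k = p \<and> l = p) - of_bool (k = 0 \<and> l = 0)"
proof -
  let ?q = "lagrange p s k * lagrange p s l"
  have inj: "inj_on s {..p}"
    using gl strict_mono_on_imp_inj_on unfolding gauss_lobatto_def by blast
  have ends: "s 0 = -1" "s p = 1"
    using gl unfolding gauss_lobatto_def by auto
  note node = poly_lagrange_node[OF inj]
  have "degree ?q \<le> 2 * p"
    using degree_mult_le[of "lagrange p s k" "lagrange p s l"]
      degree_lagrange_le[OF k, of s] degree_lagrange_le[OF l, of s] by linarith
  \<comment> \<open>Differentiation brings the degree of the product down to the exactness bound of
    the quadrature, so the weighted sum is the exact integral.\<close>
  then have "degree (pderiv ?q) \<le> 2 * p - 1"
    by (simp add: degree_pderiv)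
  then have "(\<Sum>j\<le>p. w j * poly (pderiv ?q) (s j)) = poly ?q 1 - poly ?q (-1)"
    using gl integral_poly_pderiv[of "-1" 1 ?q] unfolding gauss_lobatto_def by auto
  also have "poly ?q 1 = of_bool (k = p \<and> l = p)"
    using node[OF order_refl k] node[OF order_refl l] ends by (auto simp: of_bool_def)
  also have "poly ?q (-1) = of_bool (k = 0 \<and> l = 0)"
    using node[OF le0 k] node[OF le0 l] ends by (auto simp: of_bool_def)
  \<comment> \<open>In the product rule the undifferentiated factor is a Kronecker delta at the
    nodes, so each of the two sums keeps a single term.\<close>
  also have "(\<Sum>j\<le>p. w j * poly (pderiv ?q) (s j))
      = (\<Sum>j\<le>p. of_bool (j = k) * (w j * Dmat p s j l))
      + (\<Sum>j\<le>p. of_bool (j = l) * (w j * Dmat p s j k))"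
    unfolding sum.distrib[symmetric]
    by (rule sum.cong[OF refl]) (simp add: pderiv_mult Dmat_def node k l algebra_simps)
  also have "\<dots> = w k * Dmat p s k l + w l * Dmat p s l k"
    using k l by (simp add: of_bool_def if_distrib[of "\<lambda>x. x * _"] cong: if_cong)
  finally show ?thesis .
qed

lemma gauss_lobatto_sum_symmetric:
  assumes gl: "gauss_lobatto p s w" and sym: "\<And>k l. a k l = a l k"
  shows "(\<Sum>k\<le>p. \<Sum>l\<le>p. w k * Dmat p s k l * a k l) = (a p p - a 0 0) / 2"
proof -
  let ?S = "\<Sum>k\<le>p. \<Sum>l\<le>p. w k * Dmat p s k l * a k l"
  have at: "(\<Sum>k\<le>p. \<Sum>l\<le>p. of_bool (k = m \<and> l = m) * a k l) = a m m" if "m \<le> p" for m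
  proof -
    have "(\<Sum>l\<le>p. of_bool (k = m \<and> l = m) * a k l) = (if k = m then a m m else 0)" for k
      using that by (cases "k = m") (simp_all add: of_bool_def if_distrib[of "\<lambda>x. x * _"] cong: if_cong)
    then show ?thesis
      using that by simp
  qed
  \<comment> \<open>Symmetry of \<open>a\<close> lets the interchange of \<open>k\<close> and
    \<open>l\<close> act on the weights alone. Adding both forms of the sum produces the combination
    that summation by parts evaluates.\<close>
  have "?S = (\<Sum>k\<le>p. \<Sum>l\<le>p. w l * Dmat p s l k * a k l)"
    by (subst sum.swap) (simp add: sym)
  then have "2 * ?S = (\<Sum>k\<le>p. \<Sum>l\<le>p. (w k * Dmat p s k l + w l * Dmat p s l k) * a k l)"
    by (simp add: distrib_right sum.distrib)
  also have "\<dots> = (\<Sum>k\<le>p. \<Sum>l\<le>p. of_bool (k = p \<and> l = p) * a k l)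
      - (\<Sum>k\<le>p. \<Sum>l\<le>p. of_bool (k = 0 \<and> l = 0) * a k l)"
    unfolding sum_subtractf[symmetric]
    by (intro sum.cong refl)
       (simp add: gauss_lobatto_summation_by_parts[OF gl] left_diff_distrib)
  also have "\<dots> = a p p - a 0 0"
    by (simp only: at[OF order_refl] at[OF le0])
  finally show ?thesis
    by simp
qed

lemma h_alpha_rho_commute: "h_alpha_rho M i a b = h_alpha_rho M i b a"
  by (simp add: h_alpha_rho_def add.commute)

text \<open>Consistency of the flux: the arithmetic means collapse and \<open>logmean\<close> takes
  its value for equal arguments. This identifies the boundary terms.\<close>

lemma h_alpha_rho_same: "h_alpha_rho M i u u = alpha i u * vel i u * rho i u"
  by (simp add: h_alpha_rho_eq avg_def logmean_def)

text \<open>Positivity of volume fraction and density cancels the divisions in the primitive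
  quantities. Mass and momentum become coordinates of the state, whose time derivatives are
  coordinates of its derivative.\<close>

lemma phase_space_conserved:
  assumes "u \<in> phase_space M"
  shows mass_pos: "0 < u $ mass_ix i"
    and alpha_rho: "alpha i u * rho i u = u $ mass_ix i"
    and alpha_rho_vel: "alpha i u * rho i u * vel i u = u $ mom_ix i"
    and kin_conserved: "kin i u = (u $ mom_ix i)\<^sup>2 / (2 * u $ mass_ix i)"
proof -
  have a: "0 < alpha i u" and r: "0 < rho i u"
    using assms by (auto simp: phase_space_def)
  show ar: "alpha i u * rho i u = u $ mass_ix i"
    using a by (simp add: rho_def)
  show m: "0 < u $ mass_ix i"
    using mult_pos_pos[OF a r] ar by simp
  show "alpha i u * rho i u * vel i u = u $ mom_ix i"
    using m by (simp add: ar vel_def)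
  have "kin i u = 1 / 2 * (alpha i u * rho i u) * (vel i u)\<^sup>2"
    by (simp add: kin_def)
  then show "kin i u = (u $ mom_ix i)\<^sup>2 / (2 * u $ mass_ix i)"
    using m unfolding ar by (simp add: vel_def field_simps power2_eq_square)
qed

lemma DERIV_vec_nth:
  assumes "(f has_vector_derivative f') F"
  shows "((\<lambda>x. f x $ j) has_real_derivative f' $ j) F"
  unfolding has_real_derivative_iff_has_vector_derivative
  by (rule bounded_linear.has_vector_derivative[OF bounded_linear_vec_nth assms])

text \<open>With r the mass, m the momentum and v = m / r, the quotient rule gives (m^2 / (2 r))' =
  v m' - v^2 r' / 2.\<close>

lemma kin_DERIV:
  assumes I: "open I" "t \<in> I"
    and diff: "(u has_vector_derivative u') (at t)"
    and \<Omega>: "\<And>\<tau>. \<tau> \<in> I \<Longrightarrow> u \<tau> \<in> phase_space M"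
  shows "((\<lambda>\<tau>. kin i (u \<tau>)) has_real_derivative
           vel i (u t) * deriv (\<lambda>\<tau>. alpha i (u \<tau>) * rho i (u \<tau>) * vel i (u \<tau>)) t
           - 1 / 2 * (vel i (u t))\<^sup>2 * deriv (\<lambda>\<tau>. alpha i (u \<tau>) * rho i (u \<tau>)) t) (at t)"
proof -
  have mass: "((\<lambda>\<tau>. u \<tau> $ mass_ix i) has_real_derivative u' $ mass_ix i) (at t)"
    and mom: "((\<lambda>\<tau>. u \<tau> $ mom_ix i) has_real_derivative u' $ mom_ix i) (at t)"
    using DERIV_vec_nth[OF diff] by auto
  have m: "0 < u t $ mass_ix i"
    using mass_pos[OF \<Omega>[OF I(2)]] .
  \<comment> \<open>The product agrees with the coordinate only on the phase space, hence on the
    open set \<open>I\<close> around \<open>t\<close>, which suffices for a derivative.\<close>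
  have "((\<lambda>\<tau>. alpha i (u \<tau>) * rho i (u \<tau>)) has_real_derivative u' $ mass_ix i) (at t)"
    by (rule has_field_derivative_transform_within_open[OF mass I])
       (simp add: alpha_rho[OF \<Omega>])
  then have d_mass: "deriv (\<lambda>\<tau>. alpha i (u \<tau>) * rho i (u \<tau>)) t = u' $ mass_ix i"
    by (rule DERIV_imp_deriv)
  have "((\<lambda>\<tau>. alpha i (u \<tau>) * rho i (u \<tau>) * vel i (u \<tau>)) has_real_derivative u' $ mom_ix i) (at t)"
    by (rule has_field_derivative_transform_within_open[OF mom I])
       (simp add: alpha_rho_vel[OF \<Omega>])
  then have d_mom: "deriv (\<lambda>\<tau>. alpha i (u \<tau>) * rho i (u \<tau>) * vel i (u \<tau>)) t = u' $ mom_ix i"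
    by (rule DERIV_imp_deriv)
  have "((\<lambda>\<tau>. (u \<tau> $ mom_ix i)\<^sup>2 / (2 * u \<tau> $ mass_ix i)) has_real_derivative
      vel i (u t) * u' $ mom_ix i - 1 / 2 * (vel i (u t))\<^sup>2 * u' $ mass_ix i) (at t)"
    using m by (auto intro!: derivative_eq_intros mass mom
        simp: vel_def field_simps power2_eq_square)
  then show ?thesis
    unfolding d_mass d_mom
    by (rule has_field_derivative_transform_within_open[OF _ I])
       (simp add: kin_conserved[OF \<Omega>])
qed

theorem theorem5p1:
  fixes M :: bn_model
    and p :: nat and s w :: "nat \<Rightarrow> real" and h :: real
    and U :: "nat \<Rightarrow> real \<Rightarrow> real ^ 7" and I :: "real set" and t :: real
    and i :: phase
  assumes "\<And>i. 0 < Cv M i" and "\<And>i. 1 < gam M i" and "\<And>i. 0 \<le> pinf M i"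
    and "chi M \<in> {0, 1 / 2, 1}" and "0 \<le> bs M"
    and "1 \<le> p" and "gauss_lobatto p s w" and "0 < h"
    and "open I" and "t \<in> I"
    and "\<And>k. k \<le> p \<Longrightarrow> U k C1_differentiable_on I"
    and "\<And>k \<tau>. k \<le> p \<Longrightarrow> \<tau> \<in> I \<Longrightarrow> U k \<tau> \<in> phase_space M"
  shows "(\<Sum>k\<le>p. vel i (U k t) * Delta_mom M p s w h U i k t
               - 1 / 2 * (vel i (U k t))\<^sup>2 * Delta_mass M p s w h U i k t)
       = h * deriv (\<lambda>\<tau>. cell_avg_kin p w i (\<lambda>k. U k \<tau>)) t
         + vel i (U p t) * kin i (U p t) - vel i (U 0 t) * kin i (U 0 t)"
proof -
  note gl = assms(7)
  define v where "v = (\<lambda>k. vel i (U k t))"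
  define H where "H = (\<lambda>k l. h_alpha_rho M i (U k t) (U l t))"
  have v: "vel i (U k t) = v k" and H: "h_alpha_rho M i (U k t) (U l t) = H k l" for k l
    by (simp_all add: v_def H_def)
  define K' where "K' = (\<lambda>k. v k * deriv (\<lambda>\<tau>. alpha i (U k \<tau>) * rho i (U k \<tau>) * vel i (U k \<tau>)) t
           - 1 / 2 * (v k)\<^sup>2 * deriv (\<lambda>\<tau>. alpha i (U k \<tau>) * rho i (U k \<tau>)) t)"
  have "((\<lambda>\<tau>. kin i (U k \<tau>)) has_real_derivative K' k) (at t)" if k: "k \<le> p" for k
  proof -
    obtain u' where "(U k has_vector_derivative u') (at t)"
      using assms(11)[OF k] assms(10) unfolding C1_differentiable_on_def by blast
    then show ?thesis
      unfolding K'_def v_def by (rule kin_DERIV[OF assms(9,10) _ assms(12)[OF k]])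
  qed
  then have "((\<lambda>\<tau>. cell_avg_kin p w i (\<lambda>k. U k \<tau>)) has_real_derivative
      1 / 2 * (\<Sum>k\<le>p. w k * K' k)) (at t)"
    unfolding cell_avg_kin_def by (intro DERIV_cmult DERIV_sum) auto
  then have time: "deriv (\<lambda>\<tau>. cell_avg_kin p w i (\<lambda>k. U k \<tau>)) t = 1 / 2 * (\<Sum>k\<le>p. w k * K' k)"
    by (rule DERIV_imp_deriv)
  have split: "v k * Delta_mom M p s w h U i k t - 1 / 2 * (v k)\<^sup>2 * Delta_mass M p s w h U i k t
      = h / 2 * (w k * K' k) + (\<Sum>l\<le>p. w k * Dmat p s k l * (v k * v l * H k l))" for k
  proof -
    \<comment> \<open>Pointwise this is v_k (v_k + v_l) - v_k^2 = v_k v_l: the mass equation removes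
      exactly the nonsymmetric part.\<close>
    have volume: "(\<Sum>l\<le>p. w k * Dmat p s k l * (v k * v l * H k l))
        = v k * (\<Sum>l\<le>p. 2 * w k * Dmat p s k l * ((v k + v l) / 2) * H k l)
        - 1 / 2 * (v k)\<^sup>2 * (\<Sum>l\<le>p. 2 * w k * Dmat p s k l * H k l)"
      unfolding sum_distrib_left sum_subtractf[symmetric]
      by (rule sum.cong[OF refl]) (simp add: field_simps power2_eq_square)
    show ?thesis
      unfolding Delta_mom_def Delta_mass_def K'_def v H volume
      by (simp only: ring_distribs) (simp add: mult_ac)
  qed
  \<comment> \<open>The diagonal flux is \<alpha> \<rho> v, so the factor 1/2 from summation by
    parts turns each end value into the kinetic energy flux.\<close>
  have boundary: "v k * v k * H k k / 2 = v k * kin i (U k t)" for k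
    by (simp add: v_def H_def h_alpha_rho_same kin_def power2_eq_square)
  have "(\<Sum>k\<le>p. v k * Delta_mom M p s w h U i k t
           - 1 / 2 * (v k)\<^sup>2 * Delta_mass M p s w h U i k t)
      = h / 2 * (\<Sum>k\<le>p. w k * K' k)
        + (\<Sum>k\<le>p. \<Sum>l\<le>p. w k * Dmat p s k l * (v k * v l * H k l))"
    unfolding split by (simp add: sum.distrib sum_distrib_left)
  also have "(\<Sum>k\<le>p. \<Sum>l\<le>p. w k * Dmat p s k l * (v k * v l * H k l))
      = (v p * v p * H p p - v 0 * v 0 * H 0 0) / 2"
  proof (rule gauss_lobatto_sum_symmetric[OF gl])
    fix k l
    have "H k l = H l k"
      unfolding H_def by (rule h_alpha_rho_commute)
    then show "v k * v l * H k l = v l * v k * H l k"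
      by simp
  qed
  finally show ?thesis
    unfolding time diff_divide_distrib boundary by (simp add: v_def)
qed

end
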